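(* Let $A$ be a symmetric real $p\times p$ matrix, $B$ a symmetric positive definite real $p\times p$ matrix, and $k\le\mathsf m_1<\mathsf m_2\le p$ positive integers. Let $U_{\mathsf m_2}$ be a $p\times\mathsf m_2$ real matrix with orthonormal columns and column span $\mathcal U_{\mathsf m_2}$, and put $H=U_{\mathsf m_2}^TAU_{\mathsf m_2}$, $K=U_{\mathsf m_2}^TBU_{\mathsf m_2}$. Let $Z_{\mathsf m_1}=[Z\ \ Z_{\mathsf m_1-k}]$ be an $\mathsf m_2\times\mathsf m_1$ matrix whose columns are generalized eigenvectors of $(H,K)$ associated with its $\mathsf m_1$ largest generalized eigenvalues in non-increasing order, normalized so that $Z_{\mathsf m_1}^TKZ_{\mathsf m_1}=I_{\mathsf m_1}$, where $Z$ is $\mathsf m_2\times k$. Let $Z_{\mathsf m_1}=Q_{\mathsf m_1}S_{\mathsf m_1}$ be its QR decomposition, with $Q_{\mathsf m_1}$ of size $\mathsf m_2\times\mathsf m_1$ with orthonormal columns and $S_{\mathsf m_1}$ of size $\mathsf m_1\times\mathsf m_1$ upper triangular, and let $S_k$ be the $\mathsf m_1\times k$ matrix consisting of the first $k$ columns of $S_{\mathsf m_1}$. Let $\mathcal U_{\mathsf m_1}$ be the column span of $U_{\mathsf m_1}=U_{\mathsf m_2}Q_{\mathsf m_1}$. Then \[ \max_{V\subset\mathcal U_{\mathsf m_1},\ V^TBV=I_k}\operatorname{tr}(V^TAV)=\max_{V\subset\mathcal U_{\mathsf m_2},\ V^TBV=I_k}\operatorname{tr}(V^TAV), \] the common value is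 the sum of the $k$ largest generalized eigenvalues of $(H,K)$, and the maximum over $\mathcal U_{\mathsf m_1}$ is attained at $V=U_{\mathsf m_2}Q_{\mathsf m_1}S_k$.
   Context: A generalized eigenpair of $(H,K)$, with $H$ symmetric and $K$ symmetric positive definite, is a pair $(\lambda,z)$ with $z\ne0$ and $Hz=\lambda Kz$; generalized eigenvalues are real and counted with multiplicity. For a subspace $\mathcal U$ of $\mathbb R^p$, the notation $V\subset\mathcal U$ means that all columns of the $p\times k$ real matrix $V$ lie in $\mathcal U$. *)

theory Defs
  imports
    "Jordan_Normal_Form.Char_Poly"
    "Jordan_Normal_Form.VS_Connect"
begin

definition trace :: "real mat \<Rightarrow> real" where
  "trace A = sum_list (diag_mat A)"

definition symmetric :: "real mat \<Rightarrow> bool" where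
  "symmetric A \<longleftrightarrow> A\<^sup>T = A"

definition sym_pos_def :: "real mat \<Rightarrow> bool" where
  "sym_pos_def B \<longleftrightarrow> symmetric B \<and>
     (\<forall>x \<in> carrier_vec (dim_row B). x \<noteq> 0\<^sub>v (dim_row B) \<longrightarrow> x \<bullet> (B *\<^sub>v x) > 0)"

definition col_span :: "real mat \<Rightarrow> real vec set" where
  "col_span U = vec_space.col_space (dim_row U) U"

definition gen_eigenpair :: "real mat \<Rightarrow> real mat \<Rightarrow> real \<Rightarrow> real vec \<Rightarrow> bool" where
  "gen_eigenpair H K l z \<longleftrightarrow>
     z \<in> carrier_vec (dim_row H) \<and> z \<noteq> 0\<^sub>v (dim_row H) \<and> H *\<^sub>v z = l \<cdot>\<^sub>v (K *\<^sub>v z)"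

text \<open>The polynomial \<open>det (x K - H)\<close> in \<open>x\<close>. For \<open>K = I\<close> it is the characteristic polynomial of \<open>H\<close>.\<close>

definition gen_char_poly :: "real mat \<Rightarrow> real mat \<Rightarrow> real poly" where
  "gen_char_poly H K = det ([:0, 1:] \<cdot>\<^sub>m map_mat (\<lambda>a. [:a:]) K + map_mat (\<lambda>a. [:- a:]) H)"

text \<open>
  The generalized eigenvalues of \<open>(H, K)\<close>, each repeated according to its multiplicity as a root
  of \<open>det (x K - H)\<close>, in non-increasing order. Only real roots are listed; for \<open>H\<close> symmetric
  and \<open>K\<close> symmetric positive definite, both \<open>m \<times> m\<close>, these are all \<open>m\<close> roots.
\<close>

definition gen_eigenvalues :: "real mat \<Rightarrow> real mat \<Rightarrow> real list" where
  "gen_eigenvalues H K = rev (sorted_list_of_multiset (proots (gen_char_poly H K)))"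

lemma poly_gen_char_poly:
  assumes "H \<in> carrier_mat n n" "K \<in> carrier_mat n n"
  shows "poly (gen_char_poly H K) l = det (l \<cdot>\<^sub>m K + (- 1) \<cdot>\<^sub>m H)"
  unfolding gen_char_poly_def
  by (rule poly_det_cong[of _ n], insert assms, auto)

lemma poly_gen_char_poly_eq_0_iff:
  assumes H: "H \<in> carrier_mat n n" and K: "K \<in> carrier_mat n n"
  shows "poly (gen_char_poly H K) l = 0 \<longleftrightarrow> (\<exists>z. gen_eigenpair H K l z)"
proof -
  let ?M = "l \<cdot>\<^sub>m K + (- 1) \<cdot>\<^sub>m H"
  have M: "?M \<in> carrier_mat n n" using H K by auto
  have *: "?M *\<^sub>v z = 0\<^sub>v n \<longleftrightarrow> H *\<^sub>v z = l \<cdot>\<^sub>v (K *\<^sub>v z)" if z: "z \<in> carrier_vec n" for z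
  proof -
    have "?M *\<^sub>v z = l \<cdot>\<^sub>v (K *\<^sub>v z) + (- 1) \<cdot>\<^sub>v (H *\<^sub>v z)"
      using H K z by (subst add_mult_distrib_mat_vec[of _ n n]) auto
    then show ?thesis using H K z by (auto simp: vec_eq_iff)
  qed
  show ?thesis
    unfolding poly_gen_char_poly[OF H K] det_0_iff_vec_prod_zero[OF M] gen_eigenpair_def
    using H * by auto
qed

lemma gen_char_poly_nonzero:
  assumes H: "H \<in> carrier_mat n n" and K: "K \<in> carrier_mat n n" and pd: "sym_pos_def K"
  shows "gen_char_poly H K \<noteq> 0"
proof
  assume 0: "gen_char_poly H K = 0"
  define q where "q = gen_char_poly K H"
  have "poly q x = 0" if "x \<noteq> 0" for x
  proof -
    obtain z where "gen_eigenpair H K (inverse x) z"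
      using poly_gen_char_poly_eq_0_iff[OF H K, of "inverse x"] 0 by auto
    then have z: "z \<in> carrier_vec n" "z \<noteq> 0\<^sub>v n" "H *\<^sub>v z = inverse x \<cdot>\<^sub>v (K *\<^sub>v z)"
      using H by (auto simp: gen_eigenpair_def)
    then have "K *\<^sub>v z = x \<cdot>\<^sub>v (H *\<^sub>v z)"
      using K that by (simp add: smult_smult_assoc)
    then show ?thesis
      unfolding q_def poly_gen_char_poly_eq_0_iff[OF K H] gen_eigenpair_def
      using z K by auto
  qed
  then have "- {0} \<subseteq> {x. poly q x = 0}" by auto
  moreover have "infinite (- {0::real})" by (simp add: infinite_UNIV_char_0)
  ultimately have "q = 0" using poly_roots_finite[of q] finite_subset by blast
  then obtain z where "gen_eigenpair K H 0 z"
    using poly_gen_char_poly_eq_0_iff[OF K H, of 0] unfolding q_def by auto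
  then have z: "z \<in> carrier_vec n" "z \<noteq> 0\<^sub>v n" "K *\<^sub>v z = 0 \<cdot>\<^sub>v (H *\<^sub>v z)"
    using K by (auto simp: gen_eigenpair_def)
  have "K *\<^sub>v z = 0\<^sub>v n" using z H by (auto simp: vec_eq_iff)
  then have "z \<bullet> (K *\<^sub>v z) = 0" using z by simp
  then show False using pd z K unfolding sym_pos_def_def by force
qed

lemma set_gen_eigenvalues:
  assumes "H \<in> carrier_mat n n" "K \<in> carrier_mat n n" "sym_pos_def K"
  shows "set (gen_eigenvalues H K) = {l. \<exists>z. gen_eigenpair H K l z}"
  using gen_char_poly_nonzero[OF assms] poly_gen_char_poly_eq_0_iff[OF assms(1,2)]
  by (simp add: gen_eigenvalues_def)

definition feasible :: "real mat \<Rightarrow> nat \<Rightarrow> real vec set \<Rightarrow> real mat set" where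
  "feasible B k W =
     {V \<in> carrier_mat (dim_row B) k. set (cols V) \<subseteq> W \<and> V\<^sup>T * B * V = 1\<^sub>m k}"

definition is_maximum :: "('a \<Rightarrow> real) \<Rightarrow> 'a set \<Rightarrow> real \<Rightarrow> bool" where
  "is_maximum f S m \<longleftrightarrow> (\<exists>x \<in> S. f x = m) \<and> (\<forall>x \<in> S. f x \<le> m)"

end

theory Submission
  imports Defs "Jordan_Normal_Form.Spectral_Radius"
begin

text \<open>Substituting \<open>V = U\<^sub>2 * W\<close> turns every admissible \<open>V\<close> in
  the span of \<open>U\<^sub>2\<close> into a matrix \<open>W\<close> that is orthonormal for
  \<open>K\<close>, and turns the objective into the trace of \<open>W\<^sup>T * H * W\<close>
  (\<open>mat_factor_through_col_span\<close>, \<open>congruence_mult\<close>). Ky Fan's principle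
  for the pencil (H, K), \<open>trace_le_sum_largest_gen_eigenvalues\<close>, bounds this trace by
  the sum of the k largest generalized eigenvalues.

  The bound is attained inside the smaller space. By \<open>Z\<^sub>1 = Q * S\<close>, the columns
  of \<open>Q * S\<^sub>k\<close> are the first k columns of \<open>Z\<^sub>1\<close>:
  \<open>K\<close>-orthonormal eigenvectors for the k largest eigenvalues. Hence
  \<open>U\<^sub>2 * Q * S\<^sub>k\<close> reaches the bound. It lies in the span of
  \<open>U\<^sub>1 = U\<^sub>2 * Q\<close>, which is contained in the span of
  \<open>U\<^sub>2\<close>, so both maxima equal the bound.

  Ky Fan's principle rests on a \<open>K\<close>-orthonormal eigenbasis whose eigenvalues appear in
  the order of \<open>gen_eigenvalues\<close> (\<open>gen_eigenvalue_eigenbasis\<close>). The basis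
  comes from deflation, \<open>symmetric_definite_pencil_diagonalization\<close>; since
  \<open>gen_eigenvalues\<close> is defined through polynomial roots,
  \<open>mset_gen_eigenvalues\<close> identifies its entries with the diagonal found there. In
  eigenbasis coordinates the trace is a weighted sum of eigenvalues with weights in [0, 1] of total
  k, largest when the weights sit on the top k.\<close>

section \<open>Symmetric bilinear forms and congruence\<close>

lemma symmetric_scalar_prod_swap:
  assumes "symmetric A" "A \<in> carrier_mat n n" "x \<in> carrier_vec n" "y \<in> carrier_vec n"
  shows "x \<bullet> (A *\<^sub>v y) = y \<bullet> (A *\<^sub>v x)"
proof -
  have "x \<bullet> (A *\<^sub>v y) = (A\<^sup>T *\<^sub>v x) \<bullet> y"
    using assms by (simp add: transpose_vec_mult_scalar)
  also have "\<dots> = y \<bullet> (A *\<^sub>v x)"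
    using assms unfolding symmetric_def by (simp add: comm_scalar_prod[of _ n])
  finally show ?thesis .
qed

lemma scalar_prod_congruence:
  fixes C H :: "real mat"
  assumes "C \<in> carrier_mat n m" "H \<in> carrier_mat n n" "x \<in> carrier_vec m" "y \<in> carrier_vec m"
  shows "x \<bullet> ((C\<^sup>T * H * C) *\<^sub>v y) = (C *\<^sub>v x) \<bullet> (H *\<^sub>v (C *\<^sub>v y))"
proof -
  have "x \<bullet> ((C\<^sup>T * H * C) *\<^sub>v y) = x \<bullet> (C\<^sup>T *\<^sub>v (H *\<^sub>v (C *\<^sub>v y)))"
    using assms assoc_mult_mat_vec[of "C\<^sup>T * H" m n C m y]
      assoc_mult_mat_vec[of "C\<^sup>T" m n H n "C *\<^sub>v y"]
    by (simp del: assoc_mult_mat)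
  also have "\<dots> = (C\<^sup>T *\<^sub>v (H *\<^sub>v (C *\<^sub>v y))) \<bullet> x"
    using assms by (intro comm_scalar_prod[of _ m]) auto
  also have "\<dots> = (H *\<^sub>v (C *\<^sub>v y)) \<bullet> (C *\<^sub>v x)"
    using assms by (intro transpose_vec_mult_scalar) auto
  also have "\<dots> = (C *\<^sub>v x) \<bullet> (H *\<^sub>v (C *\<^sub>v y))"
    using assms by (intro comm_scalar_prod[of _ n]) auto
  finally show ?thesis .
qed

lemma symmetric_congruence:
  assumes "C \<in> carrier_mat n m" "H \<in> carrier_mat n n" "symmetric H"
  shows "symmetric (C\<^sup>T * H * C)"
  using assms transpose_mult[of "C\<^sup>T" m n "H * C" m] transpose_mult[of H n n C m]
  unfolding symmetric_def by simp

lemma sym_pos_def_congruence: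
  assumes C: "C \<in> carrier_mat n m" and K: "K \<in> carrier_mat n n" and pd: "sym_pos_def K"
    and inj: "\<And>x::real vec. x \<in> carrier_vec m \<Longrightarrow> C *\<^sub>v x = 0\<^sub>v n \<Longrightarrow> x = 0\<^sub>v m"
  shows "sym_pos_def (C\<^sup>T * K * C)"
  unfolding sym_pos_def_def
proof (intro conjI ballI impI)
  show "symmetric (C\<^sup>T * K * C)"
    using assms symmetric_congruence unfolding sym_pos_def_def by blast
  fix x :: "real vec"
  assume x: "x \<in> carrier_vec (dim_row (C\<^sup>T * K * C))" "x \<noteq> 0\<^sub>v (dim_row (C\<^sup>T * K * C))"
  then have x: "x \<in> carrier_vec m" "x \<noteq> 0\<^sub>v m" using C by auto
  then have "C *\<^sub>v x \<noteq> 0\<^sub>v n" "C *\<^sub>v x \<in> carrier_vec n" using inj C by auto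
  then show "x \<bullet> ((C\<^sup>T * K * C) *\<^sub>v x) > 0"
    using pd K unfolding scalar_prod_congruence[OF C K x(1) x(1)] sym_pos_def_def by auto
qed

lemma sym_pos_def_ge_0:
  assumes "sym_pos_def K" "K \<in> carrier_mat n n" "x \<in> carrier_vec n"
  shows "x \<bullet> (K *\<^sub>v x) \<ge> 0"
  using assms by (cases "x = 0\<^sub>v n") (auto simp: sym_pos_def_def less_imp_le)

lemma sym_pos_def_right_inverse:
  assumes K: "K \<in> carrier_mat n n" and pd: "sym_pos_def K"
  obtains L where "L \<in> carrier_mat n n" "K * L = 1\<^sub>m n"
proof -
  have "det K \<noteq> 0"
  proof
    assume "det K = 0"
    then obtain v where "v \<in> carrier_vec n" "v \<noteq> 0\<^sub>v n" "K *\<^sub>v v = 0\<^sub>v n"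
      using det_0_iff_vec_prod_zero[OF K] by auto
    then show False using pd K unfolding sym_pos_def_def by force
  qed
  from det_non_zero_imp_unit[OF K this, of "()"] that show ?thesis
    unfolding Units_def ring_mat_def by auto
qed

section \<open>Existence of a real generalized eigenpair\<close>

text \<open>The inverse of \<open>K\<close> times \<open>H\<close> is self-adjoint for the inner
  product given by \<open>K\<close>. It has a complex eigenvector; self-adjointness makes the
  eigenvalue real, so the real and imaginary parts of the vector satisfy the eigenvector equation
  separately, and one of them is nonzero.\<close>

lemma gen_eigenpair_exists:
  assumes H: "H \<in> carrier_mat n n" and K: "K \<in> carrier_mat n n"
    and sH: "symmetric H" and pd: "sym_pos_def K" and n: "0 < n"
  obtains l z where "gen_eigenpair H K l z"
proof -
  obtain L where L: "L \<in> carrier_mat n n" and KL: "K * L = 1\<^sub>m n"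
    using sym_pos_def_right_inverse[OF K pd] .
  define M where "M = L * H"
  have M: "M \<in> carrier_mat n n" unfolding M_def using L H by simp
  have KM: "K * M = H" unfolding M_def using assoc_mult_mat[OF K L H] KL H by simp
  have sK: "symmetric K" using pd unfolding sym_pos_def_def by simp
  obtain c v where "eigenvector (map_mat complex_of_real M) v c"
    using spectrum_non_empty[of "map_mat complex_of_real M" n] M n
    unfolding spectrum_def eigenvalue_def by auto
  then have v: "v \<in> carrier_vec n" "v \<noteq> 0\<^sub>v n" "map_mat complex_of_real M *\<^sub>v v = c \<cdot>\<^sub>v v"
    using M unfolding eigenvector_def by auto
  define x y where "x = map_vec Re v" and "y = map_vec Im v"
  define a b where "a = Re c" and "b = Im c"
  have xy: "x \<in> carrier_vec n" "y \<in> carrier_vec n" using v unfolding x_def y_def by auto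
  have e: "(map_mat complex_of_real M *\<^sub>v v) $ i = c * v $ i" if "i < n" for i
    using v(1) that unfolding v(3) by simp
  \<comment> \<open>The real part of \<open>M v = c v\<close>, with v = x + iy and c = a + ib;
    \<open>My\<close> is the imaginary part.\<close>
  have Mx: "M *\<^sub>v x = a \<cdot>\<^sub>v x + (- b) \<cdot>\<^sub>v y"
  proof (rule eq_vecI)
    fix i assume "i < dim_vec (a \<cdot>\<^sub>v x + (- b) \<cdot>\<^sub>v y)"
    then have i: "i < n" using xy by simp
    show "(M *\<^sub>v x) $ i = (a \<cdot>\<^sub>v x + (- b) \<cdot>\<^sub>v y) $ i"
      using arg_cong[OF e[OF i], of Re] i v(1) M
      by (simp add: scalar_prod_def x_def y_def a_def b_def)
  qed (use M xy in auto)
  have My: "M *\<^sub>v y = b \<cdot>\<^sub>v x + a \<cdot>\<^sub>v y"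
  proof (rule eq_vecI)
    fix i assume "i < dim_vec (b \<cdot>\<^sub>v x + a \<cdot>\<^sub>v y)"
    then have i: "i < n" using xy by simp
    show "(M *\<^sub>v y) $ i = (b \<cdot>\<^sub>v x + a \<cdot>\<^sub>v y) $ i"
      using arg_cong[OF e[OF i], of Im] i v(1) M
      by (simp add: scalar_prod_def x_def y_def a_def b_def)
  qed (use M xy in auto)
  have Kc: "K *\<^sub>v w \<in> carrier_vec n" if "w \<in> carrier_vec n" for w using K that by simp
  have lin: "K *\<^sub>v (s \<cdot>\<^sub>v x + t \<cdot>\<^sub>v y) = s \<cdot>\<^sub>v (K *\<^sub>v x) + t \<cdot>\<^sub>v (K *\<^sub>v y)" for s t
    using K xy by (simp add: mult_add_distrib_mat_vec[of _ n n] mult_mat_vec[of _ n n])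
  have Hx: "H *\<^sub>v x = a \<cdot>\<^sub>v (K *\<^sub>v x) + (- b) \<cdot>\<^sub>v (K *\<^sub>v y)"
    using assoc_mult_mat_vec[OF K M xy(1)] unfolding KM Mx lin .
  have Hy: "H *\<^sub>v y = b \<cdot>\<^sub>v (K *\<^sub>v x) + a \<cdot>\<^sub>v (K *\<^sub>v y)"
    using assoc_mult_mat_vec[OF K M xy(2)] unfolding KM My lin .
  \<comment> \<open>Expanding both sides, the terms with \<open>a\<close> cancel by symmetry of
    \<open>K\<close>. What remains is \<open>b\<close> times the sum of the \<open>K\<close>-norms
    squared of \<open>x\<close> and \<open>y\<close>, which is positive, so \<open>b\<close>
    vanishes.\<close>
  have "y \<bullet> (H *\<^sub>v x) = x \<bullet> (H *\<^sub>v y)"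
    using symmetric_scalar_prod_swap[OF sH H xy(2,1)] .
  then have "a * (y \<bullet> (K *\<^sub>v x)) + (- b) * (y \<bullet> (K *\<^sub>v y)) = b * (x \<bullet> (K *\<^sub>v x)) + a * (x \<bullet> (K *\<^sub>v y))"
    unfolding Hx Hy using xy Kc
    by (simp add: scalar_prod_add_distrib[of _ n])
  then have bb: "b * (x \<bullet> (K *\<^sub>v x) + y \<bullet> (K *\<^sub>v y)) = 0"
    using symmetric_scalar_prod_swap[OF sK K xy(2,1)] by (simp add: algebra_simps)
  have ne: "x \<noteq> 0\<^sub>v n \<or> y \<noteq> 0\<^sub>v n"
  proof (rule ccontr)
    assume "\<not> ?thesis"
    then have z: "x = 0\<^sub>v n" "y = 0\<^sub>v n" by auto
    have "v $ i = 0" if "i < n" for i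
      using arg_cong[OF z(1), of "\<lambda>u. u $ i"] arg_cong[OF z(2), of "\<lambda>u. u $ i"] that v(1)
      unfolding x_def y_def by (simp add: complex_eq_iff)
    then show False using v by (auto simp: vec_eq_iff)
  qed
  then have "x \<bullet> (K *\<^sub>v x) + y \<bullet> (K *\<^sub>v y) > 0"
    using sym_pos_def_ge_0[OF pd K xy(1)] sym_pos_def_ge_0[OF pd K xy(2)] pd xy K
    unfolding sym_pos_def_def by (auto intro: add_pos_nonneg add_nonneg_pos)
  with bb have b0: "b = 0" by simp
  have "H *\<^sub>v x = a \<cdot>\<^sub>v (K *\<^sub>v x)" "H *\<^sub>v y = a \<cdot>\<^sub>v (K *\<^sub>v y)"
    unfolding Hx Hy b0 using Kc[OF xy(1)] Kc[OF xy(2)] by (auto simp: vec_eq_iff)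
  then show ?thesis using ne xy H that unfolding gen_eigenpair_def by auto
qed

section \<open>Deflation and simultaneous diagonalization\<close>

text \<open>Supplies a basis of the hyperplane orthogonal to \<open>w\<close>, for use in deflation.
  With a pivot \<open>q\<close> where \<open>w\<close> is nonzero, the vectors e_i - (w_i / w_q) e_q
  for i different from q are orthogonal to \<open>w\<close> and independent.\<close>

lemma orthogonal_complement_mat:
  fixes w :: "real vec"
  assumes w: "w \<in> carrier_vec (Suc n)" and w0: "w \<noteq> 0\<^sub>v (Suc n)"
  obtains C where "C \<in> carrier_mat (Suc n) n"
    and "\<And>x. x \<in> carrier_vec n \<Longrightarrow> w \<bullet> (C *\<^sub>v x) = 0"
    and "\<And>x. x \<in> carrier_vec n \<Longrightarrow> C *\<^sub>v x = 0\<^sub>v (Suc n) \<Longrightarrow> x = 0\<^sub>v n"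
proof -
  obtain q where q: "q < Suc n" "w $ q \<noteq> 0" using w w0 by (auto simp: vec_eq_iff)
  \<comment> \<open>\<open>I\<close> enumerates the indices other than the pivot
    \<open>q\<close>.\<close>
  define I where "I j = (if j < q then j else Suc j)" for j
  have I: "I j \<noteq> q" "j < n \<Longrightarrow> I j < Suc n" "I i = I j \<longleftrightarrow> i = j" for i j
    using q by (auto simp: I_def split: if_splits)
  define c where "c j = unit_vec (Suc n) (I j) + (- w $ I j / w $ q) \<cdot>\<^sub>v unit_vec (Suc n) q" for j
  define C where "C = mat_of_cols (Suc n) (map c [0..<n])"
  have cc: "c j \<in> carrier_vec (Suc n)" for j unfolding c_def by simp
  have C: "C \<in> carrier_mat (Suc n) n" unfolding C_def by (simp add: mat_of_cols_def)
  have col: "col C j = c j" if "j < n" for j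
    unfolding C_def using that cc by simp
  have wc: "w \<bullet> c j = 0" if "j < n" for j
    unfolding c_def using w q I(2)[OF that]
    by (simp add: scalar_prod_add_distrib[of _ "Suc n"])
  have "w \<bullet> (C *\<^sub>v x) = 0" if x: "x \<in> carrier_vec n" for x
  proof -
    have "C\<^sup>T *\<^sub>v w = 0\<^sub>v n"
      using C w cc wc col by (intro eq_vecI) (auto simp: comm_scalar_prod[of _ "Suc n" w])
    then show ?thesis using transpose_vec_mult_scalar[OF C x w] x by simp
  qed
  moreover have "x = 0\<^sub>v n" if x: "x \<in> carrier_vec n" and Cx: "C *\<^sub>v x = 0\<^sub>v (Suc n)" for x
  proof (rule eq_vecI)
    fix i assume "i < dim_vec (0\<^sub>v n :: real vec)"
    then have i: "i < n" by simp
    \<comment> \<open>Away from the pivot row, \<open>C\<close> is an identity matrix, so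
      \<open>x\<close> can be read off from \<open>C *\<^sub>v x\<close>.\<close>
    have "row C (I i) = unit_vec n i"
      using C I i q cc unfolding C_def
      by (intro eq_vecI) (auto simp: mat_of_cols_def c_def)
    then have "(C *\<^sub>v x) $ I i = x $ i" using C x i I(2)[OF i] by simp
    then show "x $ i = 0\<^sub>v n $ i" using Cx I(2)[OF i] i by simp
  qed (use x in auto)
  ultimately show ?thesis using that C by blast
qed

lemma index_congruence:
  fixes X M :: "real mat"
  assumes X: "X \<in> carrier_mat n m" and M: "M \<in> carrier_mat n n" and ij: "i < m" "j < m"
  shows "(X\<^sup>T * M * X) $$ (i, j) = col X i \<bullet> (M *\<^sub>v col X j)"
proof -
  have "X\<^sup>T * M * X = X\<^sup>T * (M * X)"
    using X M by (intro assoc_mult_mat) auto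
  then have "(X\<^sup>T * M * X) $$ (i, j) = col X i \<bullet> col (M * X) j"
    using X M ij by (simp del: assoc_mult_mat)
  also have "col (M * X) j = M *\<^sub>v col X j"
    using X M ij by (intro col_mult2) auto
  finally show ?thesis .
qed

text \<open>Induction by deflation: split off a \<open>K\<close>-normalized eigenvector
  \<open>z\<close> and compress both forms to the \<open>K\<close>-orthogonal complement of
  \<open>z\<close>, where \<open>K\<close> stays positive definite. Since \<open>H z\<close> is a
  multiple of \<open>K z\<close>, this complement is also orthogonal to \<open>z\<close> for
  \<open>H\<close>.\<close>

lemma symmetric_definite_pencil_diagonalization:
  assumes "H \<in> carrier_mat n n" "K \<in> carrier_mat n n" "symmetric H" "sym_pos_def K"
  shows "\<exists>v d. \<forall>i < n. v i \<in> carrier_vec n \<and>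
    (\<forall>j < n. v i \<bullet> (K *\<^sub>v v j) = (if i = j then 1 else 0) \<and>
             v i \<bullet> (H *\<^sub>v v j) = (if i = j then d i else 0))"
  using assms
proof (induction n arbitrary: H K)
  case (Suc n)
  note H = Suc.prems(1) and K = Suc.prems(2) and sH = Suc.prems(3) and pd = Suc.prems(4)
  have sK: "symmetric K" using pd unfolding sym_pos_def_def by simp
  obtain l y where "gen_eigenpair H K l y"
    using gen_eigenpair_exists[OF H K sH pd] by auto
  then have y: "y \<in> carrier_vec (Suc n)" "y \<noteq> 0\<^sub>v (Suc n)" "H *\<^sub>v y = l \<cdot>\<^sub>v (K *\<^sub>v y)"
    using H unfolding gen_eigenpair_def by auto
  define r where "r = y \<bullet> (K *\<^sub>v y)"
  have r: "r > 0" using pd y K unfolding r_def sym_pos_def_def by auto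
  define z where "z = (1 / sqrt r) \<cdot>\<^sub>v y"
  have z: "z \<in> carrier_vec (Suc n)" unfolding z_def using y by simp
  have Kz: "K *\<^sub>v z \<in> carrier_vec (Suc n)" using K z by simp
  have zz: "z \<bullet> (K *\<^sub>v z) = 1"
    using r y K mult_mat_vec[OF K y(1)] unfolding z_def by (simp add: r_def[symmetric])
  have Hz: "H *\<^sub>v z = l \<cdot>\<^sub>v (K *\<^sub>v z)"
    unfolding z_def mult_mat_vec[OF H y(1)] mult_mat_vec[OF K y(1)] y(3)
    by (simp add: smult_smult_assoc mult.commute)
  have "K *\<^sub>v z \<noteq> 0\<^sub>v (Suc n)" using zz z by auto
  then obtain C where C: "C \<in> carrier_mat (Suc n) n"
    and orth: "\<And>x. x \<in> carrier_vec n \<Longrightarrow> (K *\<^sub>v z) \<bullet> (C *\<^sub>v x) = 0"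
    and inj: "\<And>x. x \<in> carrier_vec n \<Longrightarrow> C *\<^sub>v x = 0\<^sub>v (Suc n) \<Longrightarrow> x = 0\<^sub>v n"
    using orthogonal_complement_mat[OF Kz] by metis
  have "C\<^sup>T * H * C \<in> carrier_mat n n" "C\<^sup>T * K * C \<in> carrier_mat n n"
    using C H K by auto
  from Suc.IH[OF this symmetric_congruence[OF C H sH] sym_pos_def_congruence[OF C K pd inj]]
  obtain u e where ue: "\<And>i. i < n \<Longrightarrow> u i \<in> carrier_vec n"
    "\<And>i j. i < n \<Longrightarrow> j < n \<Longrightarrow> u i \<bullet> ((C\<^sup>T * K * C) *\<^sub>v u j) = (if i = j then 1 else 0)"
    "\<And>i j. i < n \<Longrightarrow> j < n \<Longrightarrow> u i \<bullet> ((C\<^sup>T * H * C) *\<^sub>v u j) = (if i = j then e i else 0)"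
    by blast
  have cong: "(C *\<^sub>v u i) \<bullet> (K *\<^sub>v (C *\<^sub>v u j)) = (if i = j then 1 else 0)"
    "(C *\<^sub>v u i) \<bullet> (H *\<^sub>v (C *\<^sub>v u j)) = (if i = j then e i else 0)" if "i < n" "j < n" for i j
    using ue that scalar_prod_congruence[OF C K, of "u i" "u j"]
      scalar_prod_congruence[OF C H, of "u i" "u j"] by metis+
  have Cu: "C *\<^sub>v u i \<in> carrier_vec (Suc n)" if "i < n" for i
    using mult_mat_vec_carrier[OF C ue(1)[OF that]] .
  have o1: "(C *\<^sub>v u i) \<bullet> (K *\<^sub>v z) = 0" if "i < n" for i
    using comm_scalar_prod[OF Kz Cu[OF that]] orth[OF ue(1)[OF that]] by simp
  have o2: "(C *\<^sub>v u i) \<bullet> (H *\<^sub>v z) = 0" if "i < n" for i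
    unfolding Hz using o1[OF that] Cu[OF that] Kz by simp
  have o3: "z \<bullet> (K *\<^sub>v (C *\<^sub>v u i)) = 0" "z \<bullet> (H *\<^sub>v (C *\<^sub>v u i)) = 0" if "i < n" for i
    using o1[OF that] o2[OF that] symmetric_scalar_prod_swap[OF sK K z Cu[OF that]]
      symmetric_scalar_prod_swap[OF sH H z Cu[OF that]] by auto
  have zH: "z \<bullet> (H *\<^sub>v z) = l" unfolding Hz using zz z Kz by simp
  show ?case
    \<comment> \<open>The new eigenvector takes index 0 and the lifted ones are shifted by
      one.\<close>
    by (rule exI[of _ "case_nat z (\<lambda>i. C *\<^sub>v u i)"], rule exI[of _ "case_nat l e"])
      (auto split: nat.split simp: z zz zH Cu cong o1 o2 o3)
qed auto

section \<open>Listed eigenvalues versus the diagonal of the pencil\<close>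

text \<open>In the eigenbasis \<open>T\<close>, \<open>det T ^ 2 * det (x K - H) = \<Prod> (x - d i)\<close>.\<close>

lemma mset_gen_eigenvalues:
  assumes H: "H \<in> carrier_mat n n" and K: "K \<in> carrier_mat n n" and T: "T \<in> carrier_mat n n"
    and TK: "T\<^sup>T * K * T = 1\<^sub>m n" and TH: "T\<^sup>T * H * T = mat_diag n d"
  shows "mset (gen_eigenvalues H K) = image_mset d (mset_set {..<n})"
proof -
  define g where "g = gen_char_poly H K"
  define c where "c = det T * det T"
  define P where "P = (\<Prod>i<n. [:- d i, 1:])"
  have "poly (Polynomial.smult c g) x = poly P x" for x
  proof -
    define M where "M = x \<cdot>\<^sub>m K + (- 1) \<cdot>\<^sub>m H"
    have M: "M \<in> carrier_mat n n" unfolding M_def using H K by simp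
    have "T\<^sup>T * M = x \<cdot>\<^sub>m (T\<^sup>T * K) + (- 1) \<cdot>\<^sub>m (T\<^sup>T * H)"
      unfolding M_def using H K T
      by (simp add: mult_add_distrib_mat[of "T\<^sup>T" n n _ n] mult_smult_distrib[of "T\<^sup>T" n n _ n])
    then have "T\<^sup>T * M * T = x \<cdot>\<^sub>m (T\<^sup>T * K * T) + (- 1) \<cdot>\<^sub>m (T\<^sup>T * H * T)"
      using H K T
      by (simp add: add_mult_distrib_mat[of _ n n _ T n] mult_smult_assoc_mat[of _ n n T n] del: assoc_mult_mat)
    also have "\<dots> = mat_diag n (\<lambda>i. x - d i)"
      unfolding TK TH by (rule eq_matI) (auto simp: mat_diag_def)
    finally have eq: "T\<^sup>T * M * T = mat_diag n (\<lambda>i. x - d i)" .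
    have "det (T\<^sup>T * M * T) = c * det M"
      using T M det_mult[of "T\<^sup>T * M" n T] det_mult[of "T\<^sup>T" n M] det_transpose[OF T]
      unfolding c_def by (simp del: assoc_mult_mat)
    moreover have "det (mat_diag n (\<lambda>i. x - d i)) = (\<Prod>i<n. x - d i)"
      by (subst det_upper_triangular[of _ n])
        (auto simp: mat_diag_def prod_list_diag_prod atLeast0LessThan intro!: upper_triangularI)
    ultimately show ?thesis
      using eq poly_gen_char_poly[OF H K, of x] unfolding g_def M_def P_def
      by (simp add: poly_prod)
  qed
  then have eq: "Polynomial.smult c g = P" by (simp add: poly_eq_poly_eq_iff[symmetric] fun_eq_iff)
  have P0: "P \<noteq> 0" unfolding P_def by simp
  \<comment> \<open>The square of \<open>det T\<close> is nonzero because the monic product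
    \<open>P\<close> is; thus scaling by \<open>c\<close> leaves the roots unchanged.\<close>
  then have "c \<noteq> 0" using eq by auto
  then have "proots g = proots P" using eq by (metis proots_smult)
  also have "\<dots> = (\<Sum>i<n. {#d i#})"
    unfolding P_def by (subst proots_prod) auto
  also have "\<dots> = image_mset d (mset_set {..<n})"
    by (simp add: sum_unfold_sum_mset)
  finally show ?thesis unfolding gen_eigenvalues_def g_def by simp
qed

text \<open>The diagonal from deflation comes in arbitrary order but agrees with
  \<open>gen_eigenvalues\<close> as a multiset, so permuting the basis vectors sorts it.\<close>

lemma gen_eigenvalue_eigenbasis:
  assumes H: "H \<in> carrier_mat n n" and K: "K \<in> carrier_mat n n"
    and sH: "symmetric H" and pd: "sym_pos_def K"
  obtains T where "T \<in> carrier_mat n n" "T\<^sup>T * K * T = 1\<^sub>m n"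
    "T\<^sup>T * H * T = mat_diag n (\<lambda>i. gen_eigenvalues H K ! i)"
    "length (gen_eigenvalues H K) = n"
proof -
  obtain v d where v: "\<And>i. i < n \<Longrightarrow> v i \<in> carrier_vec n"
    and vK: "\<And>i j. i < n \<Longrightarrow> j < n \<Longrightarrow> v i \<bullet> (K *\<^sub>v v j) = (if i = j then 1 else 0)"
    and vH: "\<And>i j. i < n \<Longrightarrow> j < n \<Longrightarrow> v i \<bullet> (H *\<^sub>v v j) = (if i = j then d i else 0)"
    using symmetric_definite_pencil_diagonalization[OF assms] by blast
  \<comment> \<open>The rearrangement \<open>f\<close> is a parameter because \<open>T\<close>
    serves twice: with the identity to compare multisets, then with the sorting permutation.\<close>
  define T where "T f = mat_of_cols n (map (\<lambda>i. v (f i)) [0..<n])" for f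
  have T: "T f \<in> carrier_mat n n" for f unfolding T_def by (simp add: mat_of_cols_def)
  have entry: "((T f)\<^sup>T * M * T f) $$ (i, j) = v (f i) \<bullet> (M *\<^sub>v v (f j))"
    if "M \<in> carrier_mat n n" and f: "\<And>i. i < n \<Longrightarrow> f i < n" and "i < n" "j < n" for f M i j
  proof -
    have "col (T f) l = v (f l)" if "l < n" for l
      unfolding T_def using that v f by simp
    then show ?thesis using index_congruence[OF T that(1,3,4)] that(3,4) by simp
  qed
  have TK: "(T f)\<^sup>T * K * T f = 1\<^sub>m n"
    and TH: "(T f)\<^sup>T * H * T f = mat_diag n (d \<circ> f)"
    if f: "\<And>i. i < n \<Longrightarrow> f i < n" and inj: "inj_on f {..<n}" for f
  proof -
    have eq: "f i = f j \<longleftrightarrow> i = j" if "i < n" "j < n" for i j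
      using inj that unfolding inj_on_def by auto
    show "(T f)\<^sup>T * K * T f = 1\<^sub>m n"
      using T[of f] by (intro eq_matI) (auto simp: entry[OF K f] vK[OF f f] eq simp del: assoc_mult_mat index_mult_mat(1))
    show "(T f)\<^sup>T * H * T f = mat_diag n (d \<circ> f)"
      using T[of f] by (intro eq_matI)
        (auto simp: entry[OF H f] vH[OF f f] eq mat_diag_def simp del: assoc_mult_mat index_mult_mat(1))
  qed
  have "mset (gen_eigenvalues H K) = image_mset d (mset_set {..<n})"
    using mset_gen_eigenvalues[OF H K T TK TH, of id] by simp
  then have ms: "mset (gen_eigenvalues H K) = mset (map d [0..<n])"
    by (simp add: mset_set_upto_eq_mset_upto)
  then obtain f where f: "f permutes {..<n}"
    and pf: "permute_list f (map d [0..<n]) = gen_eigenvalues H K"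
    by (metis mset_eq_permutation length_map length_upt minus_nat.diff_0)
  have len: "length (gen_eigenvalues H K) = n"
    using arg_cong[OF pf, of length] by simp
  have fn: "f i < n" if "i < n" for i using permutes_in_image[OF f] that by simp
  have nth: "gen_eigenvalues H K ! i = (d \<circ> f) i" if "i < n" for i
    using permute_list_nth[of f "map d [0..<n]" i] f fn that unfolding pf by simp
  have inj: "inj_on f {..<n}" using f permutes_inj_on by blast
  have "mat_diag n (d \<circ> f) = mat_diag n (\<lambda>i. gen_eigenvalues H K ! i)"
    using nth by (intro eq_matI) (auto simp: mat_diag_def)
  then show ?thesis using that[OF T TK[OF fn inj] _ len] TH[OF fn inj] by simp
qed

section \<open>Ky Fan's maximum principle\<close>

lemma congruence_mult:
  fixes U M W :: "real mat"
  assumes "U \<in> carrier_mat n m" "M \<in> carrier_mat n n" "W \<in> carrier_mat m k"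
  shows "(U * W)\<^sup>T * M * (U * W) = W\<^sup>T * (U\<^sup>T * M * U) * W"
  using assms transpose_mult[of U n m W k] assoc_mult_mat[of "W\<^sup>T" k m "U\<^sup>T" n M n]
    assoc_mult_mat[of "W\<^sup>T" k m "U\<^sup>T * M" n "U * W" k] assoc_mult_mat[of "U\<^sup>T * M" m n U m W k]
    assoc_mult_mat[of "W\<^sup>T" k m "U\<^sup>T * M * U" m W k] mult_carrier_mat[of "U\<^sup>T * M" m n U m]
  by (simp del: assoc_mult_mat)

text \<open>Compare \<open>r\<close> with the indicator \<open>s\<close> of the first k indices,
  using the k-th value \<open>c\<close> as threshold: \<open>a i - c\<close> and
  \<open>s i - r i\<close> never have opposite signs. Summing their products, the part with
  \<open>c\<close> cancels because \<open>s\<close> and \<open>r\<close> both have total k.\<close>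

lemma weighted_sum_le_sum_largest:
  fixes a r :: "nat \<Rightarrow> real"
  assumes k: "0 < k" "k \<le> n"
    and a: "\<And>i j. i \<le> j \<Longrightarrow> j < n \<Longrightarrow> a j \<le> a i"
    and r: "\<And>i. i < n \<Longrightarrow> 0 \<le> r i" "\<And>i. i < n \<Longrightarrow> r i \<le> 1" "(\<Sum>i<n. r i) = real k"
  shows "(\<Sum>i<n. a i * r i) \<le> (\<Sum>i<k. a i)"
proof -
  define c where "c = a (k - 1)"
  define s where "s i = (if i < k then 1 else 0 :: real)" for i
  have "(a i - c) * (s i - r i) \<ge> 0" if "i < n" for i
  proof (cases "i < k")
    case True
    then show ?thesis unfolding s_def c_def using a[of i "k - 1"] k r(2)[OF that] by simp
  next
    case False
    then show ?thesis unfolding s_def c_def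
      using a[of "k - 1" i] that r(1)[OF that] by (simp add: mult_nonpos_nonneg)
  qed
  then have "0 \<le> (\<Sum>i<n. (a i - c) * (s i - r i))" by (intro sum_nonneg) simp
  also have "\<dots> = (\<Sum>i<n. a i * s i) - (\<Sum>i<n. a i * r i) - c * ((\<Sum>i<n. s i) - (\<Sum>i<n. r i))"
    by (simp add: algebra_simps sum.distrib sum_subtractf sum_distrib_left)
  also have "(\<Sum>i<n. a i * s i) = (\<Sum>i<k. a i)"
    unfolding s_def using k by (intro sum.mono_neutral_cong_right) auto
  also have "(\<Sum>i<n. s i) = (\<Sum>i<k. 1)"
    unfolding s_def using k by (intro sum.mono_neutral_cong_right) auto
  finally show ?thesis using r(3) by simp
qed

text \<open>The row sum is a diagonal entry of the orthogonal projector
  \<open>Y * Y\<^sup>T\<close>. A symmetric idempotent \<open>P\<close> satisfies P_ii = sum over l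
  of P_il^2, which is at least P_ii^2, so P_ii is at most 1.\<close>

lemma row_square_sum_le_1:
  fixes Y :: "real mat"
  assumes Y: "Y \<in> carrier_mat n k" and orth: "Y\<^sup>T * Y = 1\<^sub>m k" and i: "i < n"
  shows "(\<Sum>j<k. (Y $$ (i, j))\<^sup>2) \<le> 1"
proof -
  define P where "P = Y * Y\<^sup>T"
  define r where "r = (\<Sum>j<k. (Y $$ (i, j))\<^sup>2)"
  have P: "P \<in> carrier_mat n n" unfolding P_def using Y by simp
  have "P * P = Y * (Y\<^sup>T * Y) * Y\<^sup>T"
    unfolding P_def using Y assoc_mult_mat[of Y n k "Y\<^sup>T" n "Y * Y\<^sup>T" n]
      assoc_mult_mat[of "Y\<^sup>T" k n Y k "Y\<^sup>T" n] assoc_mult_mat[of Y n k "Y\<^sup>T * Y" k "Y\<^sup>T" n]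
    by (simp del: assoc_mult_mat)
  then have PP: "P * P = P" unfolding orth P_def using Y by simp
  have PT: "P\<^sup>T = P" unfolding P_def using Y by (simp add: transpose_mult[of _ n k])
  have sym: "P $$ (l, i) = P $$ (i, l)" if "l < n" for l
    using arg_cong[OF PT, of "\<lambda>M. M $$ (i, l)"] P i that by simp
  have rP: "P $$ (i, i) = r"
    unfolding P_def r_def using Y i by (simp add: scalar_prod_def power2_eq_square atLeast0LessThan)
  have "r = (P * P) $$ (i, i)" unfolding PP rP ..
  also have "\<dots> = (\<Sum>l<n. (P $$ (i, l))\<^sup>2)"
    using P i by (simp add: scalar_prod_def power2_eq_square atLeast0LessThan sym)
  also have "\<dots> \<ge> (P $$ (i, i))\<^sup>2"
    using i by (intro member_le_sum) auto
  finally have "r * r \<le> r * 1" unfolding rP power2_eq_square by simp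
  moreover have "0 \<le> r" unfolding r_def by (simp add: sum_nonneg)
  ultimately show ?thesis unfolding r_def[symmetric]
    by (cases "r = 0") (auto simp: mult_le_cancel_left)
qed

lemma trace_eq_sum: "M \<in> carrier_mat n n \<Longrightarrow> trace M = (\<Sum>i<n. M $$ (i, i))"
  unfolding trace_def diag_mat_def
  by (simp add: interv_sum_list_conv_sum_set_nat atLeast0LessThan)

lemma gen_eigenvalues_antimono:
  assumes "i \<le> j" "j < length (gen_eigenvalues H K)"
  shows "gen_eigenvalues H K ! j \<le> gen_eigenvalues H K ! i"
  using assms unfolding gen_eigenvalues_def
  by (intro sorted_rev_nth_mono) auto

text \<open>Ky Fan's maximum principle for a symmetric-definite pencil: in the coordinates \<open>Y\<close> of \<open>W\<close> with
  respect to an eigenbasis, the trace is \<open>\<Sum> \<lambda>\<^sub>i r\<^sub>i\<close>, where the squared row norms \<open>r\<^sub>i\<close> of \<open>Y\<close> lie in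
  \<open>[0, 1]\<close> and sum up to \<open>k\<close>.\<close>

lemma trace_le_sum_largest_gen_eigenvalues:
  assumes H: "H \<in> carrier_mat n n" and K: "K \<in> carrier_mat n n"
    and sH: "symmetric H" and pd: "sym_pos_def K"
    and W: "W \<in> carrier_mat n k" and WK: "W\<^sup>T * K * W = 1\<^sub>m k" and k: "0 < k" "k \<le> n"
  shows "trace (W\<^sup>T * H * W) \<le> sum_list (take k (gen_eigenvalues H K))"
proof -
  define ev where "ev = gen_eigenvalues H K"
  obtain T where T: "T \<in> carrier_mat n n" and TK: "T\<^sup>T * K * T = 1\<^sub>m n"
    and TH: "T\<^sup>T * H * T = mat_diag n (\<lambda>i. ev ! i)" and len: "length ev = n"
    using gen_eigenvalue_eigenbasis[OF H K sH pd] unfolding ev_def .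
  \<comment> \<open>\<open>T\<^sup>T * K\<close> is a left inverse of the square matrix
    \<open>T\<close>, hence also a right inverse; this makes \<open>Y\<close> below the coordinate
    matrix of \<open>W\<close> in the eigenbasis.\<close>
  have TTK: "T * (T\<^sup>T * K) = 1\<^sub>m n"
    using mat_mult_left_right_inverse[of "T\<^sup>T * K" n T] T K TK by simp
  define Y where "Y = T\<^sup>T * K * W"
  have Y: "Y \<in> carrier_mat n k" unfolding Y_def using T K W by simp
  have WY: "W = T * Y"
  proof -
    have "T * Y = T * (T\<^sup>T * K) * W"
      unfolding Y_def using T K W by (intro assoc_mult_mat[symmetric]) auto
    then show ?thesis unfolding TTK using W by simp
  qed
  have cong: "W\<^sup>T * M * W = Y\<^sup>T * ((T\<^sup>T * M * T) * Y)" if "M \<in> carrier_mat n n" for M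
    using T Y that congruence_mult[OF T that Y] assoc_mult_mat[of "Y\<^sup>T" k n "T\<^sup>T * M * T" n Y k]
      mult_carrier_mat[of "T\<^sup>T * M" n n T n]
    unfolding WY by (simp del: assoc_mult_mat)
  have YY: "Y\<^sup>T * Y = 1\<^sub>m k" using cong[OF K] Y unfolding TK WK by simp
  define r where "r i = (\<Sum>j<k. (Y $$ (i, j))\<^sup>2)" for i
  have DY: "mat_diag n (\<lambda>i. ev ! i) * Y = mat n k (\<lambda>(i, j). ev ! i * Y $$ (i, j))"
    by (rule mat_diag_mult_left[OF Y])
  have "trace (W\<^sup>T * H * W) = (\<Sum>j<k. \<Sum>i<n. Y $$ (i, j) * (ev ! i * Y $$ (i, j)))"
    unfolding cong[OF H] TH DY using Y
    by (subst trace_eq_sum[of _ k]) (auto simp: scalar_prod_def atLeast0LessThan)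
  also have "\<dots> = (\<Sum>j<k. \<Sum>i<n. ev ! i * (Y $$ (i, j))\<^sup>2)"
    by (simp add: power2_eq_square mult.left_commute)
  also have "\<dots> = (\<Sum>i<n. ev ! i * r i)"
    unfolding r_def sum_distrib_left by (rule sum.swap)
  also have "\<dots> \<le> (\<Sum>i<k. ev ! i)"
  proof (rule weighted_sum_le_sum_largest[OF k])
    show "ev ! j \<le> ev ! i" if "i \<le> j" "j < n" for i j
      using gen_eigenvalues_antimono that len unfolding ev_def by simp
    show "0 \<le> r i" for i unfolding r_def by (simp add: sum_nonneg)
    show "r i \<le> 1" if "i < n" for i
      unfolding r_def by (rule row_square_sum_le_1[OF Y YY that])
    \<comment> \<open>Each of the k columns of \<open>Y\<close> is a unit vector, so exchanging the
      two sums gives total weight k.\<close>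
    have "(\<Sum>i<n. (Y $$ (i, j))\<^sup>2) = 1" if "j < k" for j
      using arg_cong[OF YY, of "\<lambda>M. M $$ (j, j)"] Y that
      by (simp add: scalar_prod_def power2_eq_square atLeast0LessThan)
    then show "(\<Sum>i<n. r i) = real k"
      unfolding r_def by (subst sum.swap) simp
  qed
  also have "\<dots> = sum_list (take k ev)"
    using k len by (simp add: sum_list_sum_nth atLeast0LessThan)
  finally show ?thesis unfolding ev_def .
qed

section \<open>Column spans as matrix factorizations\<close>

lemma col_span_eq:
  "col_span U = {U *\<^sub>v x | x. x \<in> carrier_vec (dim_col U)}"
proof -
  have U: "U \<in> carrier_mat (dim_row U) (dim_col U)" by simp
  show ?thesis
    unfolding col_span_def vec_space.col_space_eq[OF U] using mult_mat_vec_carrier[OF U] by auto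
qed

lemma mat_factor_through_col_span:
  assumes U: "U \<in> carrier_mat n m" and V: "V \<in> carrier_mat n k"
    and sub: "set (cols V) \<subseteq> col_span U"
  obtains W where "W \<in> carrier_mat m k" "V = U * W"
proof -
  have "\<exists>x \<in> carrier_vec m. col V j = U *\<^sub>v x" if "j < k" for j
  proof -
    have "col V j \<in> col_span U" using sub that V by (auto simp: cols_def)
    then show ?thesis using U unfolding col_span_eq by auto
  qed
  then obtain x where x: "\<And>j. j < k \<Longrightarrow> x j \<in> carrier_vec m"
    "\<And>j. j < k \<Longrightarrow> col V j = U *\<^sub>v x j" by metis
  define W where "W = mat_of_cols m (map x [0..<k])"
  have W: "W \<in> carrier_mat m k" unfolding W_def by (simp add: mat_of_cols_def)
  have "col W j = x j" if "j < k" for j unfolding W_def using that x by simp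
  then have "V = U * W"
    using U V W x(2) by (intro mat_col_eqI) (auto simp: col_mult2[of _ n m _ k])
  then show ?thesis using that W by blast
qed

lemma cols_mult_subset_col_span:
  assumes "U \<in> carrier_mat n m" "W \<in> carrier_mat m k"
  shows "set (cols (U * W)) \<subseteq> col_span U"
proof
  fix v assume "v \<in> set (cols (U * W))"
  then obtain j where "j < k" "v = col (U * W) j" using assms by (auto simp: cols_def)
  then have "v = U *\<^sub>v col W j" "col W j \<in> carrier_vec (dim_col U)"
    using assms by (auto simp only: col_mult2 carrier_matD col_carrier_vec)
  then show "v \<in> col_span U" unfolding col_span_eq by blast
qed

section \<open>Compression to the two subspaces and attainment\<close>

theorem mainTheorem8:
  fixes A B U\<^sub>2 H K Z Z' Z\<^sub>1 Q S S\<^sub>k U\<^sub>1 :: "real mat"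
    and p k m\<^sub>1 m\<^sub>2 :: nat
  assumes "A \<in> carrier_mat p p" and "symmetric A"
    and "B \<in> carrier_mat p p" and "sym_pos_def B"
    and "0 < k" and "k \<le> m\<^sub>1" and "m\<^sub>1 < m\<^sub>2" and "m\<^sub>2 \<le> p"
    and "U\<^sub>2 \<in> carrier_mat p m\<^sub>2" and "U\<^sub>2\<^sup>T * U\<^sub>2 = 1\<^sub>m m\<^sub>2"
    and "H = U\<^sub>2\<^sup>T * A * U\<^sub>2" and "K = U\<^sub>2\<^sup>T * B * U\<^sub>2"
    and "Z \<in> carrier_mat m\<^sub>2 k" and "Z' \<in> carrier_mat m\<^sub>2 (m\<^sub>1 - k)"
    and "Z\<^sub>1 = mat_of_cols m\<^sub>2 (cols Z @ cols Z')"
    and "\<forall>i < m\<^sub>1. gen_eigenpair H K (gen_eigenvalues H K ! i) (col Z\<^sub>1 i)"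
    and "Z\<^sub>1\<^sup>T * K * Z\<^sub>1 = 1\<^sub>m m\<^sub>1"
    and "Q \<in> carrier_mat m\<^sub>2 m\<^sub>1" and "Q\<^sup>T * Q = 1\<^sub>m m\<^sub>1"
    and "S \<in> carrier_mat m\<^sub>1 m\<^sub>1" and "upper_triangular S"
    and "Z\<^sub>1 = Q * S"
    and "S\<^sub>k = mat_of_cols m\<^sub>1 (take k (cols S))"
    and "U\<^sub>1 = U\<^sub>2 * Q"
  shows "is_maximum (\<lambda>V. trace (V\<^sup>T * A * V)) (feasible B k (col_span U\<^sub>1))
           (sum_list (take k (gen_eigenvalues H K)))
       \<and> is_maximum (\<lambda>V. trace (V\<^sup>T * A * V)) (feasible B k (col_span U\<^sub>2))
           (sum_list (take k (gen_eigenvalues H K)))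
       \<and> U\<^sub>2 * Q * S\<^sub>k \<in> feasible B k (col_span U\<^sub>1)
       \<and> trace ((U\<^sub>2 * Q * S\<^sub>k)\<^sup>T * A * (U\<^sub>2 * Q * S\<^sub>k)) =
           sum_list (take k (gen_eigenvalues H K))"
proof -
  note A = assms(1) and sA = assms(2) and B = assms(3) and pd = assms(4) and U\<^sub>2 = assms(9)
    and Q = assms(18) and S = assms(20)
  note H_def = assms(11) and K_def = assms(12) and Z\<^sub>1_def = assms(15) and S\<^sub>k_def = assms(23)
  define ev where "ev = gen_eigenvalues H K"
  have H: "H \<in> carrier_mat m\<^sub>2 m\<^sub>2" and K: "K \<in> carrier_mat m\<^sub>2 m\<^sub>2"
    unfolding H_def K_def using A B U\<^sub>2 by auto
  have sH: "symmetric H" unfolding H_def by (rule symmetric_congruence[OF U\<^sub>2 A sA])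
  have pdK: "sym_pos_def K" unfolding K_def
  proof (rule sym_pos_def_congruence[OF U\<^sub>2 B pd])
    \<comment> \<open>Orthonormal columns make \<open>U\<^sub>2\<close> injective, so compressing
      \<open>B\<close> keeps it positive definite.\<close>
    fix x assume x: "x \<in> carrier_vec m\<^sub>2" and "U\<^sub>2 *\<^sub>v x = 0\<^sub>v p"
    then have "U\<^sub>2\<^sup>T * U\<^sub>2 *\<^sub>v x = 0\<^sub>v m\<^sub>2"
      using U\<^sub>2 by (subst assoc_mult_mat_vec[of _ m\<^sub>2 p _ m\<^sub>2]) auto
    then show "x = 0\<^sub>v m\<^sub>2" using assms(10) x by simp
  qed
  have Z\<^sub>1: "Z\<^sub>1 \<in> carrier_mat m\<^sub>2 m\<^sub>1"
    unfolding assms(22) using Q S by simp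
  have S\<^sub>k: "S\<^sub>k \<in> carrier_mat m\<^sub>1 k"
    unfolding S\<^sub>k_def using S assms(6) by (simp add: mat_of_cols_def)
  define X where "X = Q * S\<^sub>k"
  have X: "X \<in> carrier_mat m\<^sub>2 k" unfolding X_def using Q S\<^sub>k by simp
  \<comment> \<open>Column i of \<open>S\<^sub>k\<close> is column i of \<open>S\<close>, so
    multiplying by \<open>Q\<close> recovers the eigenvector in column i of
    \<open>Z\<^sub>1\<close>.\<close>
  have colX: "col X i = col Z\<^sub>1 i" if "i < k" for i
  proof -
    have "col S\<^sub>k i = col S i" unfolding S\<^sub>k_def using that S assms(6)
      by (subst col_mat_of_cols) auto
    then show ?thesis unfolding X_def assms(22)
      using that S assms(6) by (simp add: col_mult2[OF Q S\<^sub>k] col_mult2[OF Q S])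
  qed
  have XKX: "col X i \<bullet> (K *\<^sub>v col X j) = (if i = j then 1 else 0)" if "i < k" "j < k" for i j
    using index_congruence[OF Z\<^sub>1 K, of i j] assms(6,17) that by (simp add: colX)
  have XK: "X\<^sup>T * K * X = 1\<^sub>m k"
    using X K index_congruence[OF X K] XKX
    by (intro eq_matI) (auto simp del: assoc_mult_mat index_mult_mat(1))
  \<comment> \<open>Only the diagonal enters the trace; there the eigenvector equation and
    \<open>K\<close>-normalization give the eigenvalue.\<close>
  have XH: "(X\<^sup>T * H * X) $$ (i, i) = ev ! i" if i: "i < k" for i
  proof -
    have "gen_eigenpair H K (ev ! i) (col X i)"
      using assms(6,16) i unfolding ev_def colX[OF i] by simp
    then have "H *\<^sub>v col X i = ev ! i \<cdot>\<^sub>v (K *\<^sub>v col X i)" unfolding gen_eigenpair_def by simp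
    then show ?thesis
      using XKX[OF i i] X K i unfolding index_congruence[OF X H i i] by simp
  qed
  have "length ev = m\<^sub>2" using gen_eigenvalue_eigenbasis[OF H K sH pdK] unfolding ev_def by metis
  then have sum_ev: "sum_list (take k ev) = (\<Sum>i<k. ev ! i)"
    using assms(6,7) by (simp add: sum_list_sum_nth atLeast0LessThan)
  define V where "V = U\<^sub>2 * Q * S\<^sub>k"
  have V1: "V = U\<^sub>1 * S\<^sub>k" unfolding V_def assms(24) ..
  have V2: "V = U\<^sub>2 * X" unfolding V_def X_def by (rule assoc_mult_mat[OF U\<^sub>2 Q S\<^sub>k])
  have U\<^sub>1: "U\<^sub>1 \<in> carrier_mat p m\<^sub>1" unfolding assms(24) using U\<^sub>2 Q by simp
  have "V\<^sup>T * B * V = 1\<^sub>m k"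
    unfolding V2 congruence_mult[OF U\<^sub>2 B X] K_def[symmetric] by (rule XK)
  moreover have "set (cols V) \<subseteq> col_span U\<^sub>1"
    unfolding V1 by (rule cols_mult_subset_col_span[OF U\<^sub>1 S\<^sub>k])
  moreover have "V \<in> carrier_mat p k" unfolding V1 using U\<^sub>1 S\<^sub>k by simp
  ultimately have V_feasible: "V \<in> feasible B k (col_span U\<^sub>1)"
    unfolding feasible_def using B by simp
  have V_trace: "trace (V\<^sup>T * A * V) = sum_list (take k ev)"
  proof -
    have "trace (V\<^sup>T * A * V) = trace (X\<^sup>T * H * X)"
      unfolding V2 congruence_mult[OF U\<^sub>2 A X] H_def ..
    also have "\<dots> = (\<Sum>i<k. ev ! i)"
      using XH X H by (subst trace_eq_sum[of _ k]) (auto simp del: assoc_mult_mat index_mult_mat(1))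
    finally show ?thesis unfolding sum_ev .
  qed
  have upper: "trace (V'\<^sup>T * A * V') \<le> sum_list (take k ev)"
    if "V' \<in> feasible B k (col_span U\<^sub>2)" for V'
  proof -
    have V': "V' \<in> carrier_mat p k" "set (cols V') \<subseteq> col_span U\<^sub>2" "V'\<^sup>T * B * V' = 1\<^sub>m k"
      using that B unfolding feasible_def by auto
    obtain W where W: "W \<in> carrier_mat m\<^sub>2 k" "V' = U\<^sub>2 * W"
      using mat_factor_through_col_span[OF U\<^sub>2 V'(1,2)] .
    have "W\<^sup>T * K * W = 1\<^sub>m k"
      using V'(3) unfolding W(2) congruence_mult[OF U\<^sub>2 B W(1)] K_def .
    then show ?thesis
      using trace_le_sum_largest_gen_eigenvalues[OF H K sH pdK W(1)] assms(5-7)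
      unfolding W(2) congruence_mult[OF U\<^sub>2 A W(1)] H_def[symmetric] ev_def by simp
  qed
  \<comment> \<open>The inclusion passes the upper bound down to \<open>U\<^sub>1\<close> and the
    maximizer \<open>V\<close> up to \<open>U\<^sub>2\<close>.\<close>
  have "col_span U\<^sub>1 \<subseteq> col_span U\<^sub>2"
    using U\<^sub>2 Q unfolding assms(24) col_span_eq
    by auto
  then have "feasible B k (col_span U\<^sub>1) \<subseteq> feasible B k (col_span U\<^sub>2)"
    unfolding feasible_def by auto
  then show ?thesis
    using V_feasible V_trace upper unfolding is_maximum_def ev_def[symmetric] V_def[symmetric] by blast
qed

end
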